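(* Let $\mathcal{V}=\mathcal{C}_{N,k}$ be the approximation space and $\mathcal{W}=\mathcal{C}_{N,2k}$ the double-grid space, with $V=\dim\mathcal{V}$ and $W=\dim\mathcal{W}$. Let $m:\Omega\to\mathbb{R}$ be a uniformly positive integrable function, and let $\mathsf{A}\in\mathbb{R}^{V\times V}$ be the system matrix of the weighted projection, $$\mathsf{A}_{ij}=\int_\Omega m(x)\,\phi_{\mathcal{V}}^j(x)\,\phi_{\mathcal{V}}^i(x)\,dx,\qquad i,j=1,\dots,V.$$ Define $\mathsf{A}^{\mathrm{DoGIP}}\in\mathbb{R}^{W\times W}$ and $\mathsf{B}\in\mathbb{R}^{W\times V}$ by $$\mathsf{A}^{\mathrm{DoGIP}}_{ij}=\delta_{ij}\int_\Omega m(x)\,\phi_{\mathcal{W}}^i(x)\,dx,\qquad \mathsf{B}_{ij}=\phi_{\mathcal{V}}^j(x_{\mathcal{W}}^i).$$ Then for all $\mathsf{u},\mathsf{v}\in\mathbb{R}^V$, $$\mathsf{A}\mathsf{u}\cdot\mathsf{v}=\mathsf{B}^*\mathsf{A}^{\mathrm{DoGIP}}\mathsf{B}\,\mathsf{u}\cdot\mathsf{v}.$$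
   Context: $\Omega\subset\mathbb{R}^d$ ($d=2$ or $3$) is a bounded open set with a finite mesh $\mathcal{M}=\mathcal{M}(\Omega)$ of non-overlapping simplexes $T$ (triangles or tetrahedra) covering $\Omega$, with no hanging nodes (a conforming simplicial mesh). The subscript $N$ is the discretisation parameter of the mesh. $\mathcal{P}_k$ is the space of real polynomials on $\mathbb{R}^d$ of total degree at most $k$, and $k\ge 1$ is an integer. For an integer $\ell\geq 1$, $$\mathcal{C}_{N,\ell}=\{v:\Omega\to\mathbb{R}\mid v|_T\in\mathcal{P}_\ell\ \ \forall T\in\mathcal{M},\ v\text{ continuous}\}.$$ Functions in $\mathcal{C}_{N,\ell}$ are evaluated at points of $\partial\Omega$ by continuous extension from elements. Each such space $\mathcal{X}=\mathcal{C}_{N,\ell}$ is equipped with its standard Lagrange finite element basis $\phi_{\mathcal{X}}^1,\dots,\phi_{\mathcal{X}}^{\dim\mathcal{X}}$ and nodal points $x_{\mathcal{X}}^1,\dots,x_{\mathcal{X}}^{\dim\mathcal{X}}$ satisfying $\phi_{\mathcal{X}}^j(x_{\mathcal{X}}^i)=\delta_{ij}$; hence $v=\sum_i v(x_{\mathcal{X}}^i)\phi_{\mathcal{X}}^i$ for all $v\in\mathcal{X}$. "Uniformly positive" means bounded below by a positive constant. $\mathsf{B}^*$ is the adjoint (transpose) of $\mathsf{B}$, and $\cdot$ is the Euclidean inner product. *)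

theory Defs
  imports
    "HOL-Analysis.Analysis"
    "HOL-Library.Function_Algebras"
    "Jordan_Normal_Form.Matrix"
begin

no_notation inner (infix "\<bullet>" 70)
no_notation vec_index (infixl "$" 100)

interpretation real_fun: vector_space "\<lambda>(c::real) (f::'a \<Rightarrow> real) x. c * f x"
  by unfold_locales (auto simp: fun_eq_iff algebra_simps)

text \<open>The elements are closed simplexes. Two elements meet in a common, possibly empty, face
  by the definition of \<^const>\<open>triangulation\<close>; as all of them have full dimension,
  distinct elements do not overlap.\<close>

definition conforming_mesh :: "(real ^ 'd) set \<Rightarrow> (real ^ 'd) set set \<Rightarrow> bool" where
  "conforming_mesh \<Omega> \<M> \<longleftrightarrow>
     triangulation \<M> \<and> (\<forall>T\<in>\<M>. int CARD('d) simplex T) \<and> \<Union>\<M> = closure \<Omega>"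

definition poly_space :: "nat \<Rightarrow> (real ^ 'd \<Rightarrow> real) set" where
  "poly_space l = {p. \<exists>c :: ('d \<Rightarrow> nat) \<Rightarrow> real.
     \<forall>x. p x = (\<Sum>\<alpha> | (\<Sum>i\<in>UNIV. \<alpha> i) \<le> l. c \<alpha> * (\<Prod>i\<in>UNIV. (x $ i) ^ \<alpha> i))}"

text \<open>A finite element function is represented on the closure of the domain, that is, together
  with its continuous extension to the boundary from the closed elements. The value 0 elsewhere
  makes the representation unique, so that the functions form a vector space of the right
  dimension.\<close>

definition fe_space ::
    "(real ^ 'd) set \<Rightarrow> (real ^ 'd) set set \<Rightarrow> nat \<Rightarrow> (real ^ 'd \<Rightarrow> real) set" where
  "fe_space \<Omega> \<M> l = {v. continuous_on (closure \<Omega>) v \<and>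
     (\<forall>T\<in>\<M>. \<exists>p\<in>poly_space l. \<forall>x\<in>T. v x = p x) \<and> (\<forall>x. x \<notin> closure \<Omega> \<longrightarrow> v x = 0)}"

definition fe_dim :: "(real ^ 'd) set \<Rightarrow> (real ^ 'd) set set \<Rightarrow> nat \<Rightarrow> nat" where
  "fe_dim \<Omega> \<M> l = real_fun.dim (fe_space \<Omega> \<M> l)"

text \<open>The principal lattice of order \<open>l\<close>: the points of a simplex whose barycentric coordinates
  with respect to its vertices are multiples of \<open>1/l\<close>.\<close>

definition lattice_points :: "nat \<Rightarrow> (real ^ 'd) set \<Rightarrow> (real ^ 'd) set" where
  "lattice_points l T =
     {\<Sum>a | a extreme_point_of T. (real (\<alpha> a) / real l) *\<^sub>R a | \<alpha> :: real ^ 'd \<Rightarrow> nat.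
        (\<Sum>a | a extreme_point_of T. \<alpha> a) = l}"

text \<open>Indices start at 0. The duality condition makes the functions \<open>\<phi> j\<close> linearly independent;
  as there are as many of them as the dimension of the space, they are a basis of it.\<close>

definition lagrange_basis ::
    "(real ^ 'd) set \<Rightarrow> (real ^ 'd) set set \<Rightarrow> nat \<Rightarrow> (nat \<Rightarrow> real ^ 'd) \<Rightarrow>
     (nat \<Rightarrow> real ^ 'd \<Rightarrow> real) \<Rightarrow> bool" where
  "lagrange_basis \<Omega> \<M> l x \<phi> \<longleftrightarrow>
     bij_betw x {..<fe_dim \<Omega> \<M> l} (\<Union>T\<in>\<M>. lattice_points l T) \<and>
     (\<forall>j<fe_dim \<Omega> \<M> l. \<phi> j \<in> fe_space \<Omega> \<M> l) \<and>
     (\<forall>i<fe_dim \<Omega> \<M> l. \<forall>j<fe_dim \<Omega> \<M> l. \<phi> j (x i) = (if i = j then 1 else 0))"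

definition system_matrix ::
    "(real ^ 'd) set \<Rightarrow> (real ^ 'd \<Rightarrow> real) \<Rightarrow> nat \<Rightarrow> (nat \<Rightarrow> real ^ 'd \<Rightarrow> real) \<Rightarrow> real mat" where
  "system_matrix \<Omega> m n \<phi> =
     mat n n (\<lambda>(i, j). LINT x:\<Omega>|lebesgue. m x * \<phi> j x * \<phi> i x)"

definition dogip_matrix ::
    "(real ^ 'd) set \<Rightarrow> (real ^ 'd \<Rightarrow> real) \<Rightarrow> nat \<Rightarrow> (nat \<Rightarrow> real ^ 'd \<Rightarrow> real) \<Rightarrow> real mat" where
  "dogip_matrix \<Omega> m n \<phi> =
     mat n n (\<lambda>(i, j). if i = j then LINT x:\<Omega>|lebesgue. m x * \<phi> i x else 0)"

definition interpolation_matrix ::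
    "nat \<Rightarrow> nat \<Rightarrow> (nat \<Rightarrow> real ^ 'd) \<Rightarrow> (nat \<Rightarrow> real ^ 'd \<Rightarrow> real) \<Rightarrow> real mat" where
  "interpolation_matrix r n x \<phi> = mat r n (\<lambda>(i, j). \<phi> j (x i))"

end

theory Submission
  imports Defs
begin

text \<open>The mass matrix integrates \<open>m\<close> against products \<open>\<phi>V j * \<phi>V i\<close> of two basis functions. Such a
  product is continuous and has degree at most \<open>2 * k\<close> on every element, so it lies in the
  double-grid space (\<open>fe_space_mult\<close>) and is reproduced exactly by Lagrange interpolation there
  (\<open>lagrange_interpolation\<close>). Integrating the interpolant against \<open>m\<close> turns interpolation into a
  quadrature rule with nodes \<open>xW l\<close> and weights \<open>\<integral> m * \<phi>W l\<close>, exact on the whole double-grid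
  space (\<open>nodal_quadrature\<close>). The interpolant of a product has the products of the nodal values
  as coefficients, and therefore
  \<open>A\<^sub>i\<^sub>j = (\<Sum>l. \<phi>V j (xW l) * \<phi>V i (xW l) * \<integral> m * \<phi>W l)\<close>. The weights are the diagonal of the
  DoGIP matrix and the nodal values are the entries of \<open>B\<close>, so the right-hand side is the entry
  \<open>(i, j)\<close> of the product of the transpose of \<open>B\<close>, the DoGIP matrix and \<open>B\<close>. The two system
  matrices thus agree entrywise, and not only as bilinear forms.

  Exactness of the interpolation follows by counting: duality at the nodes makes the Lagrange
  functions linearly independent, and there are as many of them as the dimension of the space.\<close>

section \<open>Products of polynomials\<close>

lemma finite_multi_indices: "finite {\<alpha> :: 'd::finite \<Rightarrow> nat. (\<Sum>i\<in>UNIV. \<alpha> i) \<le> l}"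
proof (rule finite_subset)
  show "{\<alpha> :: 'd \<Rightarrow> nat. (\<Sum>i\<in>UNIV. \<alpha> i) \<le> l} \<subseteq> UNIV \<rightarrow>\<^sub>E {..l}"
  proof (clarsimp simp: PiE_def)
    fix \<alpha> :: "'d \<Rightarrow> nat" and i
    assume "(\<Sum>i\<in>UNIV. \<alpha> i) \<le> l"
    moreover have "\<alpha> i \<le> (\<Sum>i\<in>UNIV. \<alpha> i)"
      by (rule member_le_sum) auto
    ultimately show "\<alpha> i \<le> l" by simp
  qed
qed (simp add: finite_PiE)

text \<open>Multiplying two monomials adds their multi-indices, so the coefficient of a multi-index \<open>\<gamma>\<close> in
  the product is the convolution of the coefficients over all pairs \<open>(\<alpha>, \<beta>)\<close> with
  \<open>\<alpha> + \<beta> = \<gamma>\<close>.\<close>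

lemma poly_space_mult:
  fixes p q :: "real ^ 'd \<Rightarrow> real"
  assumes "p \<in> poly_space k" and "q \<in> poly_space l"
  shows "(\<lambda>x. p x * q x) \<in> poly_space (k + l)"
proof -
  let ?I = "\<lambda>n. {\<alpha> :: 'd \<Rightarrow> nat. (\<Sum>i\<in>UNIV. \<alpha> i) \<le> n}"
  let ?mon = "\<lambda>(x :: real ^ 'd) \<alpha>. \<Prod>i\<in>UNIV. (x $ i) ^ \<alpha> i"
  let ?add = "\<lambda>(\<alpha> :: 'd \<Rightarrow> nat, \<beta>) i. \<alpha> i + \<beta> i"
  from assms obtain c d where p: "\<And>x. p x = (\<Sum>\<alpha>\<in>?I k. c \<alpha> * ?mon x \<alpha>)"
    and q: "\<And>x. q x = (\<Sum>\<beta>\<in>?I l. d \<beta> * ?mon x \<beta>)"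
    unfolding poly_space_def by blast
  define e where "e \<gamma> = (\<Sum>z | z \<in> ?I k \<times> ?I l \<and> ?add z = \<gamma>. c (fst z) * d (snd z))" for \<gamma>
  have "p x * q x = (\<Sum>\<gamma>\<in>?I (k + l). e \<gamma> * ?mon x \<gamma>)" for x
  proof -
    have "p x * q x = (\<Sum>z\<in>?I k \<times> ?I l. c (fst z) * d (snd z) * ?mon x (?add z))"
      unfolding p q sum_product sum.cartesian_product
      by (rule sum.cong) (auto simp: power_add prod.distrib)
    also have "\<dots> = (\<Sum>\<gamma>\<in>?I (k + l). \<Sum>z | z \<in> ?I k \<times> ?I l \<and> ?add z = \<gamma>.
        c (fst z) * d (snd z) * ?mon x (?add z))"
      by (rule sum.group[symmetric])
        (auto simp: finite_multi_indices sum.distrib intro: add_mono)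
    also have "\<dots> = (\<Sum>\<gamma>\<in>?I (k + l). e \<gamma> * ?mon x \<gamma>)"
      unfolding e_def sum_distrib_right by (intro sum.cong refl) auto
    finally show ?thesis .
  qed
  then show ?thesis
    unfolding poly_space_def by blast
qed

lemma fe_space_mult:
  assumes "f \<in> fe_space \<Omega> \<M> k" and "g \<in> fe_space \<Omega> \<M> l"
  shows "(\<lambda>x. f x * g x) \<in> fe_space \<Omega> \<M> (k + l)"
proof -
  have "\<exists>r\<in>poly_space (k + l). \<forall>x\<in>T. f x * g x = r x" if "T \<in> \<M>" for T
  proof -
    from assms that obtain p q where "p \<in> poly_space k" "\<forall>x\<in>T. f x = p x"
      and "q \<in> poly_space l" "\<forall>x\<in>T. g x = q x"
      unfolding fe_space_def by blast
    then show ?thesis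
      by (intro bexI[of _ "\<lambda>x. p x * q x"] poly_space_mult) auto
  qed
  with assms show ?thesis
    unfolding fe_space_def by (auto intro: continuous_on_mult)
qed

section \<open>Nodal interpolation\<close>

lemma sum_fun_apply: "(\<Sum>i\<in>I. f i) x = (\<Sum>i\<in>I. f i x)"
  for f :: "'i \<Rightarrow> 'a \<Rightarrow> 'b::comm_monoid_add"
  by (induction I rule: infinite_finite_induct) auto

text \<open>Duality makes the functions \<open>\<phi> j\<close> linearly independent: evaluation at \<open>x i\<close> picks out the
  coefficient of \<open>\<phi> i\<close>. There are as many of them as the dimension of \<open>S\<close>, so they span \<open>S\<close>,
  and the same evaluation identifies the coefficients of \<open>f\<close>.\<close>

lemma nodal_expansion:
  fixes \<phi> :: "nat \<Rightarrow> 'a \<Rightarrow> real"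
  assumes \<phi>: "\<And>j. j < n \<Longrightarrow> \<phi> j \<in> S"
    and dual: "\<And>i j. i < n \<Longrightarrow> j < n \<Longrightarrow> \<phi> j (x i) = (if i = j then 1 else 0)"
    and dim: "real_fun.dim S = n" and "n > 0" and f: "f \<in> S"
  shows "f y = (\<Sum>j<n. f (x j) * \<phi> j y)"
proof -
  have inj: "inj_on \<phi> {..<n}"
  proof (rule inj_onI)
    fix i j
    assume "i \<in> {..<n}" "j \<in> {..<n}" "\<phi> i = \<phi> j"
    with dual[of i i] dual[of i j] show "i = j"
      by (simp split: if_splits)
  qed
  have eval: "(\<Sum>g\<in>\<phi> ` {..<n}. c g * g (x i)) = c (\<phi> i)" if "i < n" for c i
  proof -
    have "(\<Sum>g\<in>\<phi> ` {..<n}. c g * g (x i)) = (\<Sum>j<n. if j = i then c (\<phi> j) else 0)"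
      unfolding sum.reindex[OF inj] using that by (intro sum.cong) (auto simp: dual)
    with that show ?thesis by simp
  qed
  have indep: "real_fun.independent (\<phi> ` {..<n})"
  proof (rule real_fun.independent_if_scalars_zero)
    fix c g
    assume zero: "(\<Sum>g\<in>\<phi> ` {..<n}. (\<lambda>y. c g * g y)) = 0" and "g \<in> \<phi> ` {..<n}"
    then obtain i where "i < n" "g = \<phi> i" by auto
    with eval[of i c] fun_cong[OF zero, of "x i"] show "c g = 0"
      by (simp add: sum_fun_apply)
  qed simp
  have "f \<in> real_fun.span (\<phi> ` {..<n})"
  proof (rule ccontr)
    assume notin: "f \<notin> real_fun.span (\<phi> ` {..<n})"
    obtain B where B: "S \<subseteq> real_fun.span B" "card B = n"
      using real_fun.basis_exists[of S] dim by metis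
    \<comment> \<open>An infinite-dimensional space is assigned dimension 0, so it is \<open>n > 0\<close> that makes
      the basis finite.\<close>
    have "finite B"
      using B(2) \<open>n > 0\<close> card_gt_0_iff by blast
    moreover have "insert f (\<phi> ` {..<n}) \<subseteq> real_fun.span B"
      using B(1) \<phi> f by auto
    ultimately have "card (insert f (\<phi> ` {..<n})) \<le> n"
      using real_fun.independent_span_bound real_fun.independent_insertI[OF notin indep] B(2)
      by metis
    moreover have "f \<notin> \<phi> ` {..<n}"
      using notin real_fun.span_base[of f "\<phi> ` {..<n}"] by auto
    ultimately show False
      by (simp add: card_image[OF inj])
  qed
  then obtain c where "f = (\<Sum>g\<in>\<phi> ` {..<n}. (\<lambda>y. c g * g y))"
    unfolding real_fun.span_finite[OF finite_imageI[OF finite_lessThan]] by blast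
  then have f_eq: "f z = (\<Sum>g\<in>\<phi> ` {..<n}. c g * g z)" for z
    by (simp add: sum_fun_apply)
  have "f y = (\<Sum>j<n. c (\<phi> j) * \<phi> j y)"
    unfolding f_eq sum.reindex[OF inj] by simp
  also have "\<dots> = (\<Sum>j<n. f (x j) * \<phi> j y)"
    by (intro sum.cong refl) (simp add: f_eq eval)
  finally show ?thesis .
qed

text \<open>Any vertex \<open>a\<close> is a lattice point, its multi-index being \<open>l\<close> at \<open>a\<close> and 0 elsewhere. This excludes
  a mesh with elements but without nodes.\<close>

lemma lattice_points_nonempty:
  fixes T :: "(real ^ 'd) set"
  assumes "int CARD('d) simplex T"
  shows "lattice_points l T \<noteq> {}"
proof -
  obtain C where C: "finite C" "int (card C) = int CARD('d) + 1" "T = convex hull C"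
    using assms unfolding simplex by blast
  have fin: "finite {a. a extreme_point_of T}"
    using C(1) extreme_points_of_convex_hull[of C] finite_subset unfolding C(3) by blast
  have "T \<noteq> {}"
    using C(2,3) by auto
  then obtain a where a: "a extreme_point_of T"
    using extreme_point_exists_convex[of T] compact_simplex[OF assms] convex_simplex[OF assms]
    by blast
  have "(\<Sum>b | b extreme_point_of T. if b = a then l else 0) = l"
    using fin a by simp
  then show ?thesis
    unfolding lattice_points_def by (auto intro!: exI[of _ "\<lambda>b. if b = a then l else 0"])
qed

text \<open>If the dimension is positive, this is the expansion above. The value 0 could also stand for
  infinite dimension, but then there are no nodes, hence no elements, and the domain is empty:
  every finite element function vanishes, as does the empty sum.\<close>

lemma lagrange_interpolation:
  assumes mesh: "conforming_mesh \<Omega> \<M>" and basis: "lagrange_basis \<Omega> \<M> l x \<phi>"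
    and f: "f \<in> fe_space \<Omega> \<M> l"
  shows "f y = (\<Sum>j<fe_dim \<Omega> \<M> l. f (x j) * \<phi> j y)"
proof (cases "fe_dim \<Omega> \<M> l = 0")
  case True
  with basis have "(\<Union>T\<in>\<M>. lattice_points l T) = {}"
    unfolding lagrange_basis_def by (simp add: bij_betw_def)
  moreover have "lattice_points l T \<noteq> {}" if "T \<in> \<M>" for T
    using mesh that by (intro lattice_points_nonempty) (simp add: conforming_mesh_def)
  ultimately have "\<M> = {}"
    by blast
  with mesh have "closure \<Omega> = {}"
    by (auto simp: conforming_mesh_def)
  with f True show ?thesis
    by (simp add: fe_space_def)
next
  case False
  with basis f show ?thesis
    unfolding lagrange_basis_def
    by (intro nodal_expansion[where S = "fe_space \<Omega> \<M> l"]) (auto simp: fe_dim_def)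
qed

section \<open>Nodal quadrature\<close>

text \<open>The closure of a bounded domain is compact, so a finite element function is bounded there, and a
  bounded measurable factor preserves integrability.\<close>

lemma set_integrable_mult_fe:
  assumes "open \<Omega>" and "bounded \<Omega>" and m: "set_integrable lebesgue \<Omega> m"
    and f: "f \<in> fe_space \<Omega> \<M> l"
  shows "set_integrable lebesgue \<Omega> (\<lambda>x. m x * f x)"
proof -
  have cont: "continuous_on (closure \<Omega>) f"
    using f by (simp add: fe_space_def)
  have \<Omega>: "\<Omega> \<in> sets lebesgue"
    using \<open>open \<Omega>\<close> by auto
  have "f \<in> borel_measurable (lebesgue_on \<Omega>)"
    using continuous_on_subset[OF cont closure_subset] \<Omega>
    by (rule continuous_imp_measurable_on_sets_lebesgue)
  moreover have "compact (f ` closure \<Omega>)"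
    using cont \<open>bounded \<Omega>\<close> by (intro compact_continuous_image) (simp_all add: compact_closure)
  then have "bounded (f ` \<Omega>)"
    using bounded_subset[OF compact_imp_bounded image_mono[OF closure_subset]] by blast
  ultimately have "set_integrable lebesgue \<Omega> (\<lambda>x. f x * m x)"
    using \<Omega> m by (intro absolutely_integrable_bounded_measurable_product[OF bilinear_times])
  then show ?thesis
    by (simp add: mult.commute)
qed

text \<open>Interpolation reproduces \<open>f\<close>, so integrating it termwise gives a quadrature rule, with the
  weight function absorbed into the weights, that is exact on the finite element space.\<close>

lemma nodal_quadrature:
  assumes "open \<Omega>" and "bounded \<Omega>" and "conforming_mesh \<Omega> \<M>"
    and basis: "lagrange_basis \<Omega> \<M> l x \<phi>"
    and "set_integrable lebesgue \<Omega> m" and f: "f \<in> fe_space \<Omega> \<M> l"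
  shows "(LINT y:\<Omega>|lebesgue. m y * f y) =
    (\<Sum>j<fe_dim \<Omega> \<M> l. f (x j) * (LINT y:\<Omega>|lebesgue. m y * \<phi> j y))"
proof -
  let ?n = "fe_dim \<Omega> \<M> l"
  have int: "integrable lebesgue (\<lambda>y. indicat_real \<Omega> y * (m y * \<phi> j y))" if "j < ?n" for j
    using set_integrable_mult_fe[of \<Omega> m "\<phi> j" \<M> l] assms that
    by (simp add: lagrange_basis_def set_integrable_def)
  have "indicat_real \<Omega> y * (m y * f y) =
      (\<Sum>j<?n. f (x j) * (indicat_real \<Omega> y * (m y * \<phi> j y)))" for y
    by (subst lagrange_interpolation[OF assms(3) basis f, of y])
      (simp add: sum_distrib_left mult_ac)
  then have "(LINT y:\<Omega>|lebesgue. m y * f y) =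
      (\<integral>y. (\<Sum>j<?n. f (x j) * (indicat_real \<Omega> y * (m y * \<phi> j y))) \<partial>lebesgue)"
    by (simp add: set_lebesgue_integral_def)
  also have "\<dots> = (\<Sum>j<?n. f (x j) * (LINT y:\<Omega>|lebesgue. m y * \<phi> j y))"
    using int by (simp add: set_lebesgue_integral_def)
  finally show ?thesis .
qed

section \<open>Factorisation of the system matrix\<close>

lemma congruence_diagonal_index:
  fixes B D :: "'a::comm_semiring_1 mat"
  assumes B: "B \<in> carrier_mat r n" and D: "D = mat r r (\<lambda>(i, j). if i = j then d i else 0)"
    and "i < n" and "j < n"
  shows "(transpose_mat B * D * B) $$ (i, j) = (\<Sum>l<r. B $$ (l, i) * d l * B $$ (l, j))"
proof -
  have "(transpose_mat B * D) $$ (i, l) = B $$ (l, i) * d l" if "l < r" for l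
  proof -
    have "(transpose_mat B * D) $$ (i, l) = (\<Sum>t<r. B $$ (t, i) * (if t = l then d t else 0))"
      using assms that by (simp add: scalar_prod_def atLeast0LessThan)
    also have "\<dots> = B $$ (l, i) * d l"
      using that by (simp add: if_distrib[of "(*) _"] cong: if_cong)
    finally show ?thesis .
  qed
  with assms show ?thesis
    by (auto simp: scalar_prod_def atLeast0LessThan intro!: sum.cong)
qed

theorem theorem3:
  fixes \<Omega> :: "(real ^ 'd) set" and \<M> :: "(real ^ 'd) set set"
    and m :: "real ^ 'd \<Rightarrow> real"
    and k V W :: nat
    and xV xW :: "nat \<Rightarrow> real ^ 'd"
    and \<phi>V \<phi>W :: "nat \<Rightarrow> real ^ 'd \<Rightarrow> real"
    and A AD B :: "real mat"
  assumes "CARD('d) = 2 \<or> CARD('d) = 3"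
    and "open \<Omega>" and "bounded \<Omega>"
    and "conforming_mesh \<Omega> \<M>"
    and "k \<ge> 1"
    and "V = fe_dim \<Omega> \<M> k" and "W = fe_dim \<Omega> \<M> (2 * k)"
    and "lagrange_basis \<Omega> \<M> k xV \<phi>V"
    and "lagrange_basis \<Omega> \<M> (2 * k) xW \<phi>W"
    and "set_integrable lebesgue \<Omega> m"
    and "\<exists>c>0. \<forall>x\<in>\<Omega>. c \<le> m x"
    and "A = system_matrix \<Omega> m V \<phi>V"
    and "AD = dogip_matrix \<Omega> m W \<phi>W"
    and "B = interpolation_matrix W V xW \<phi>V"
  shows "\<forall>u\<in>carrier_vec V. \<forall>v\<in>carrier_vec V.
    (A *\<^sub>v u) \<bullet> v = ((transpose_mat B * AD * B) *\<^sub>v u) \<bullet> v"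
proof -
  have "A $$ (i, j) = (transpose_mat B * AD * B) $$ (i, j)" if "i < V" "j < V" for i j
  proof -
    have "(\<lambda>x. \<phi>V j x * \<phi>V i x) \<in> fe_space \<Omega> \<M> (k + k)"
      using assms(6,8) that by (intro fe_space_mult) (auto simp: lagrange_basis_def)
    then have prod: "(\<lambda>x. \<phi>V j x * \<phi>V i x) \<in> fe_space \<Omega> \<M> (2 * k)"
      by (simp add: mult_2)
    have "A $$ (i, j) = (LINT x:\<Omega>|lebesgue. m x * (\<phi>V j x * \<phi>V i x))"
      using that by (simp add: assms(12) system_matrix_def mult.assoc)
    also have "\<dots> = (\<Sum>l<W. \<phi>V j (xW l) * \<phi>V i (xW l) * (LINT x:\<Omega>|lebesgue. m x * \<phi>W l x))"
      using nodal_quadrature[OF assms(2-4,9,10) prod] assms(7) by simp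
    also have "\<dots> = (\<Sum>l<W. B $$ (l, i) * (LINT x:\<Omega>|lebesgue. m x * \<phi>W l x) * B $$ (l, j))"
      using that by (intro sum.cong) (auto simp: assms(14) interpolation_matrix_def)
    also have "\<dots> = (transpose_mat B * AD * B) $$ (i, j)"
      by (rule congruence_diagonal_index[symmetric, OF _ _ that])
        (simp_all add: assms(13,14) interpolation_matrix_def dogip_matrix_def)
    finally show ?thesis .
  qed
  then have "A = transpose_mat B * AD * B"
    by (intro eq_matI) (simp_all add: assms(12,14) system_matrix_def interpolation_matrix_def)
  then show ?thesis
    by simp
qed

end
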